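(* Let $N\ge 1$ be an integer and consider an $N$-box PPS scenario (as defined in the context) with pre-selected state $\rho_I$, post-selected state $\rho_F$ and box basis $B=\{|b\rangle\}_{b=1}^{N+1}$ of $\mathbb{C}^{N+1}$. Then the ABL statistics satisfy $$\sum_{b=1}^{N}p(b\mid\rho_I,\rho_F,\mathcal{M}_b)=1-\mathrm{Re}\big(\langle\Pi_{N+1}\rangle_w\big).$$ Consequently, a paradox occurs if and only if the weak value of the excluded projector $\Pi_{N+1}$ has negative real part, $$\mathrm{Re}\big(\langle\Pi_{N+1}\rangle_w\big)<0,$$ that is, if and only if $\langle\Pi_{N+1}\rangle_w$ is anomalous.
   Context: A state on $\mathbb{C}^d$ is a density operator (positive semidefinite, trace one). $N$-box PPS (pre- and post-selection) scenario. The data are states $\rho_I$ (pre-selected) and $\rho_F$ (post-selected) on $\mathbb{C}^{N+1}$, and an orthonormal basis $B=\{|b\rangle\}_{b=1}^{N+1}$ of $\mathbb{C}^{N+1}$ (the box basis). Write $\Pi_b=|b\rangle\langle b|$ and $\Pi_b^{\perp}=\mathbb{1}-\Pi_b$. The intermediate measurement $\mathcal{M}_b=\{\Pi_b,\mathbb{1}-\Pi_b\}$ is performed for $b\in\{1,\dots,N\}$ only ($\mathcal{M}_{N+1}$ is excluded), and the post-selection measurement is $\mathcal{M}_F=\{\rho_F,\mathbb{1}-\rho_F\}$, with "pass" denoting outcome $\rho_F$. The probabilities (Lüders rule) are $$p(b,\mathrm{pass})=\mathrm{Tr}[\rho_F\Pi_b\rho_I\Pi_b],\qquad p(\neg b,\mathrm{pass})=\mathrm{Tr}[\rho_F\Pi_b^{\perp}\rho_I\Pi_b^{\perp}],\qquad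 p(\mathrm{pass}\mid\rho_I,\mathcal{M}_F)=\mathrm{Tr}[\rho_F\rho_I],$$ the last one being the probability of passing when no intermediate measurement is performed. The scenario is required to satisfy: (i) operational non-disturbance: $p(b,\mathrm{pass})+p(\neg b,\mathrm{pass})=p(\mathrm{pass}\mid\rho_I,\mathcal{M}_F)$ for all $b\in\{1,\dots,N\}$; (ii) $p(\mathrm{pass}\mid\rho_I,\mathcal{M}_F)=\mathrm{Tr}[\rho_F\rho_I]\neq 0$; (iii) no two boxes are found occupied in sequential intermediate measurements without post-selection: $p(b,b'\mid\rho_I,\mathcal{M}_b,\mathcal{M}_{b'})=\mathrm{Tr}[\Pi_{b'}\Pi_b\rho_I\Pi_b\Pi_{b'}]=0$ for all $b\ne b'$. ABL (Aharonov–Bergmann–Lebowitz) rule: for $b\in\{1,\dots,N\}$, $$p(b\mid\rho_I,\rho_F,\mathcal{M}_b)=\frac{p(b,\mathrm{pass})}{p(b,\mathrm{pass})+p(\neg b,\mathrm{pass})}.$$ A paradox is a violation of the inequality $\sum_{b=1}^{N}p(b\mid\rho_I,\rho_F,\mathcal{M}_b)\le 1$. Weak value of a Hermitian operator $A$ with pre-selected state $\rho_I$ and post-selected state $\rho_F$: $$\langle A\rangle_w=\frac{\mathrm{Tr}[\rho_F A\rho_I]}{\mathrm{Tr}[\rho_F\rho_I]}\in\mathbb{C}.$$ The weak value $\langle A\rangle_w$ is called anomalous whenever it lies outside the interval $[\lambda_{\min},\lambda_{\max}]\subset\mathbb{R}$ given by the smallest and largest eigenvalues of $A$. For $A=\Pi_{N+1}$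 this interval is $[0,1]$.
   Formalization: The final "iff anomalous" fails for non-real weak values with nonnegative real part (e.g. (1-i)/2 with N=1); it is proved with the real part of the weak value outside [0,1], and literally when the weak value is real; paradox implies anomalous is proved in general. *)

theory Defs
  imports "Jordan_Normal_Form.Schur_Decomposition" "Jordan_Normal_Form.VS_Connect"
begin

definition mtrace :: "complex mat \<Rightarrow> complex" where
  "mtrace A = (\<Sum>i<dim_row A. A $$ (i, i))"

definition hermitian_mat :: "nat \<Rightarrow> complex mat \<Rightarrow> bool" where
  "hermitian_mat d A \<longleftrightarrow> A \<in> carrier_mat d d \<and> mat_adjoint A = A"

text \<open>The order on \<^typ>\<open>complex\<close> is \<open>z \<le> w \<longleftrightarrow> Re z \<le> Re w \<and> Im z = Im w\<close>, so
  \<open>0 \<le> z\<close> says that \<open>z\<close> is a nonnegative real.\<close>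

definition psd_mat :: "nat \<Rightarrow> complex mat \<Rightarrow> bool" where
  "psd_mat d A \<longleftrightarrow> hermitian_mat d A \<and> (\<forall>v\<in>carrier_vec d. 0 \<le> (A *\<^sub>v v) \<bullet>c v)"

definition density_op :: "nat \<Rightarrow> complex mat \<Rightarrow> bool" where
  "density_op d \<rho> \<longleftrightarrow> psd_mat d \<rho> \<and> mtrace \<rho> = 1"

text \<open>Basis vectors are indexed by \<open>{1..d}\<close>.\<close>

definition orthonormal_basis :: "nat \<Rightarrow> (nat \<Rightarrow> complex vec) \<Rightarrow> bool" where
  "orthonormal_basis d e \<longleftrightarrow>
     (\<forall>i\<in>{1..d}. e i \<in> carrier_vec d) \<and>
     (\<forall>i\<in>{1..d}. \<forall>j\<in>{1..d}. e i \<bullet>c e j = (if i = j then 1 else 0)) \<and>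
     vectorspace.basis class_ring (module_vec TYPE(complex) d) (e ` {1..d})"

text \<open>The projector \<open>|v\<rangle>\<langle>v|\<close> and its complement.\<close>

definition proj :: "complex vec \<Rightarrow> complex mat" where
  "proj v = mat (dim_vec v) (dim_vec v) (\<lambda>(i, j). v $ i * cnj (v $ j))"

definition proj_perp :: "complex vec \<Rightarrow> complex mat" where
  "proj_perp v = 1\<^sub>m (dim_vec v) - proj v"

text \<open>The traces defining the probabilities are real (see \<open>p_box_trace\<close>, \<open>p_notbox_trace\<close>,
  \<open>p_pass_trace\<close> and \<open>p_seq_trace\<close> below); \<^const>\<open>Re\<close> only moves them to type \<^typ>\<open>real\<close>.
  The arguments are the pre-selected state, the post-selected state and the box vector(s).\<close>

definition p_box :: "complex mat \<Rightarrow> complex mat \<Rightarrow> complex vec \<Rightarrow> real" where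
  "p_box \<rho>I \<rho>F v = Re (mtrace (\<rho>F * proj v * \<rho>I * proj v))"

definition p_notbox :: "complex mat \<Rightarrow> complex mat \<Rightarrow> complex vec \<Rightarrow> real" where
  "p_notbox \<rho>I \<rho>F v = Re (mtrace (\<rho>F * proj_perp v * \<rho>I * proj_perp v))"

definition p_pass :: "complex mat \<Rightarrow> complex mat \<Rightarrow> real" where
  "p_pass \<rho>I \<rho>F = Re (mtrace (\<rho>F * \<rho>I))"

definition p_seq :: "complex mat \<Rightarrow> complex vec \<Rightarrow> complex vec \<Rightarrow> real" where
  "p_seq \<rho>I v v' = Re (mtrace (proj v' * proj v * \<rho>I * proj v * proj v'))"

definition PPS_scenario ::
  "nat \<Rightarrow> complex mat \<Rightarrow> complex mat \<Rightarrow> (nat \<Rightarrow> complex vec) \<Rightarrow> bool" where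
  "PPS_scenario N \<rho>I \<rho>F e \<longleftrightarrow>
     density_op (N + 1) \<rho>I \<and> density_op (N + 1) \<rho>F \<and> orthonormal_basis (N + 1) e \<and>
     (\<forall>b\<in>{1..N}. p_box \<rho>I \<rho>F (e b) + p_notbox \<rho>I \<rho>F (e b) = p_pass \<rho>I \<rho>F) \<and>
     p_pass \<rho>I \<rho>F \<noteq> 0 \<and>
     (\<forall>b\<in>{1..N}. \<forall>b'\<in>{1..N}. b \<noteq> b' \<longrightarrow> p_seq \<rho>I (e b) (e b') = 0)"

definition abl :: "complex mat \<Rightarrow> complex mat \<Rightarrow> complex vec \<Rightarrow> real" where
  "abl \<rho>I \<rho>F v = p_box \<rho>I \<rho>F v / (p_box \<rho>I \<rho>F v + p_notbox \<rho>I \<rho>F v)"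

definition paradox ::
  "nat \<Rightarrow> complex mat \<Rightarrow> complex mat \<Rightarrow> (nat \<Rightarrow> complex vec) \<Rightarrow> bool" where
  "paradox N \<rho>I \<rho>F e \<longleftrightarrow> \<not> (\<Sum>b = 1..N. abl \<rho>I \<rho>F (e b)) \<le> 1"

definition weak_value :: "complex mat \<Rightarrow> complex mat \<Rightarrow> complex mat \<Rightarrow> complex" where
  "weak_value \<rho>I \<rho>F A = mtrace (\<rho>F * A * \<rho>I) / mtrace (\<rho>F * \<rho>I)"

definition spectral_interval :: "complex mat \<Rightarrow> real set" where
  "spectral_interval A =
     {Min {r. eigenvalue A (complex_of_real r)} .. Max {r. eigenvalue A (complex_of_real r)}}"

text \<open>Two readings of ``the weak value lies outside the spectral interval''. For the first, the
  weak value itself, a complex number, is not in the interval, so every non-real weak value is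
  anomalous. For the second, its real part is not in the interval. The readings agree on real weak
  values, but not in general: see \<open>anomalous_without_paradox\<close> below.\<close>

definition anomalous :: "complex mat \<Rightarrow> complex mat \<Rightarrow> complex mat \<Rightarrow> bool" where
  "anomalous \<rho>I \<rho>F A \<longleftrightarrow> weak_value \<rho>I \<rho>F A \<notin> complex_of_real ` spectral_interval A"

definition anomalous_Re :: "complex mat \<Rightarrow> complex mat \<Rightarrow> complex mat \<Rightarrow> bool" where
  "anomalous_Re \<rho>I \<rho>F A \<longleftrightarrow> Re (weak_value \<rho>I \<rho>F A) \<notin> spectral_interval A"


subsection \<open>The traces are real\<close>

lemma mat_adjoint_index:
  assumes "i < dim_col A" "j < dim_row A"
  shows "mat_adjoint A $$ (i, j) = conjugate (A $$ (j, i))"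
  using assms by (simp add: mat_adjoint_def mat_of_rows_def)

lemma hermitian_mat_iff:
  "hermitian_mat d A \<longleftrightarrow>
     A \<in> carrier_mat d d \<and> (\<forall>i<d. \<forall>j<d. A $$ (i, j) = cnj (A $$ (j, i)))"
proof (cases "A \<in> carrier_mat d d")
  case True
  have "mat_adjoint A = A \<longleftrightarrow> (\<forall>i<d. \<forall>j<d. A $$ (i, j) = cnj (A $$ (j, i)))"
  proof
    assume h: "mat_adjoint A = A"
    show "\<forall>i<d. \<forall>j<d. A $$ (i, j) = cnj (A $$ (j, i))"
    proof (intro allI impI)
      fix i j assume "i < d" "j < d"
      then have "mat_adjoint A $$ (i, j) = cnj (A $$ (j, i))"
        using True by (simp add: mat_adjoint_index)
      then show "A $$ (i, j) = cnj (A $$ (j, i))" by (simp add: h)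
    qed
  next
    assume h: "\<forall>i<d. \<forall>j<d. A $$ (i, j) = cnj (A $$ (j, i))"
    have dims: "dim_row (mat_adjoint A) = d" "dim_col (mat_adjoint A) = d"
      using True by (auto simp: mat_adjoint_def)
    show "mat_adjoint A = A"
    proof (rule eq_matI)
      fix i j assume "i < dim_row A" "j < dim_col A"
      then have ij: "i < d" "j < d" using True by auto
      have "mat_adjoint A $$ (i, j) = cnj (A $$ (j, i))"
        using True ij by (simp add: mat_adjoint_index)
      then show "mat_adjoint A $$ (i, j) = A $$ (i, j)" using h ij by metis
    qed (use dims True in auto)
  qed
  then show ?thesis using True by (simp add: hermitian_mat_def)
qed (simp add: hermitian_mat_def)

lemma hermitian_matD:
  assumes "hermitian_mat d A"
  shows "A \<in> carrier_mat d d" "i < d \<Longrightarrow> j < d \<Longrightarrow> cnj (A $$ (i, j)) = A $$ (j, i)"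
  using assms unfolding hermitian_mat_iff by metis+

lemma mult_index:
  assumes "A \<in> carrier_mat d d" "B \<in> carrier_mat d d" "i < d" "j < d"
  shows "(A * B) $$ (i, j) = (\<Sum>k<d. A $$ (i, k) * B $$ (k, j))"
  using assms by (auto simp: scalar_prod_def atLeast0LessThan intro!: sum.cong)

lemma hermitian_conj:
  assumes "hermitian_mat d P" "hermitian_mat d A"
  shows "hermitian_mat d (P * A * P)"
proof -
  have P: "P \<in> carrier_mat d d" "\<And>i j. i < d \<Longrightarrow> j < d \<Longrightarrow> cnj (P $$ (i, j)) = P $$ (j, i)"
    and A: "A \<in> carrier_mat d d" "\<And>i j. i < d \<Longrightarrow> j < d \<Longrightarrow> cnj (A $$ (i, j)) = A $$ (j, i)"
    using hermitian_matD[OF assms(1)] hermitian_matD[OF assms(2)] by blast+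
  have PA: "P * A \<in> carrier_mat d d" using P(1) A(1) by auto
  have idx: "(P * A * P) $$ (i, j) = (\<Sum>k<d. \<Sum>l<d. P $$ (i, l) * A $$ (l, k) * P $$ (k, j))"
    if "i < d" "j < d" for i j
  proof -
    have "(P * A * P) $$ (i, j) = (\<Sum>k<d. (P * A) $$ (i, k) * P $$ (k, j))"
      using mult_index[OF PA P(1) that] .
    also have "\<dots> = (\<Sum>k<d. (\<Sum>l<d. P $$ (i, l) * A $$ (l, k)) * P $$ (k, j))"
      using that(1) by (intro sum.cong refl) (simp only: mult_index[OF P(1) A(1)] lessThan_iff)
    finally show ?thesis by (simp add: sum_distrib_right)
  qed
  have "(P * A * P) $$ (i, j) = cnj ((P * A * P) $$ (j, i))" if ij: "i < d" "j < d" for i j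
  proof -
    have "cnj ((P * A * P) $$ (j, i)) =
        (\<Sum>k<d. \<Sum>l<d. P $$ (l, j) * A $$ (k, l) * P $$ (i, k))"
      unfolding idx[OF ij(2,1)] cnj_sum using ij by (intro sum.cong refl) (simp add: P(2) A(2))
    also have "\<dots> = (\<Sum>l<d. \<Sum>k<d. P $$ (l, j) * A $$ (k, l) * P $$ (i, k))"
      by (rule sum.swap)
    also have "\<dots> = (P * A * P) $$ (i, j)"
      unfolding idx[OF ij] by (simp add: mult_ac)
    finally show ?thesis by simp
  qed
  moreover have "P * A * P \<in> carrier_mat d d" using PA P(1) by auto
  ultimately show ?thesis unfolding hermitian_mat_iff by blast
qed

lemma mtrace_hermitian:
  assumes "hermitian_mat d A"
  shows "mtrace A = complex_of_real (Re (mtrace A))"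
proof -
  have "cnj (A $$ (i, i)) = A $$ (i, i)" if "i < d" for i
    using assms that by (simp add: hermitian_matD)
  moreover have "dim_row A = d" using hermitian_matD(1)[OF assms] by auto
  ultimately have "cnj (mtrace A) = mtrace A" by (simp add: mtrace_def cnj_sum)
  then show ?thesis by (simp add: complex_eq_iff)
qed

lemma mtrace_hermitian_mult:
  assumes "hermitian_mat d A" "hermitian_mat d B"
  shows "mtrace (A * B) = complex_of_real (Re (mtrace (A * B)))"
proof -
  have A: "A \<in> carrier_mat d d" "\<And>i j. i < d \<Longrightarrow> j < d \<Longrightarrow> cnj (A $$ (i, j)) = A $$ (j, i)"
    and B: "B \<in> carrier_mat d d" "\<And>i j. i < d \<Longrightarrow> j < d \<Longrightarrow> cnj (B $$ (i, j)) = B $$ (j, i)"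
    using hermitian_matD[OF assms(1)] hermitian_matD[OF assms(2)] by blast+
  have tr: "mtrace (A * B) = (\<Sum>i<d. \<Sum>k<d. A $$ (i, k) * B $$ (k, i))"
    using A(1) B(1) mult_index[OF A(1) B(1)] by (simp add: mtrace_def)
  have "cnj (mtrace (A * B)) = (\<Sum>i<d. \<Sum>k<d. A $$ (k, i) * B $$ (i, k))"
    unfolding tr cnj_sum by (intro sum.cong refl) (simp add: A(2) B(2))
  also have "\<dots> = mtrace (A * B)" unfolding tr by (rule sum.swap)
  finally show ?thesis by (simp add: complex_eq_iff)
qed

lemma hermitian_proj: "v \<in> carrier_vec d \<Longrightarrow> hermitian_mat d (proj v)"
  by (auto simp: hermitian_mat_iff proj_def)

lemma hermitian_proj_perp: "v \<in> carrier_vec d \<Longrightarrow> hermitian_mat d (proj_perp v)"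
  by (auto simp: hermitian_mat_iff proj_perp_def proj_def)

lemma p_box_trace:
  assumes "hermitian_mat d \<rho>I" "hermitian_mat d \<rho>F" "v \<in> carrier_vec d"
  shows "mtrace (\<rho>F * proj v * \<rho>I * proj v) = complex_of_real (p_box \<rho>I \<rho>F v)"
proof -
  have c: "\<rho>F \<in> carrier_mat d d" "\<rho>I \<in> carrier_mat d d" "proj v \<in> carrier_mat d d"
    using assms hermitian_proj[OF assms(3)] by (auto simp: hermitian_mat_def)
  have "\<rho>F * proj v * \<rho>I * proj v = \<rho>F * (proj v * \<rho>I * proj v)"
    using c by (simp add: assoc_mult_mat[of _ d d _ d _ d])
  then show ?thesis
    using mtrace_hermitian_mult[OF assms(2) hermitian_conj[OF hermitian_proj[OF assms(3)] assms(1)]]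
    by (simp add: p_box_def)
qed

lemma p_notbox_trace:
  assumes "hermitian_mat d \<rho>I" "hermitian_mat d \<rho>F" "v \<in> carrier_vec d"
  shows "mtrace (\<rho>F * proj_perp v * \<rho>I * proj_perp v) = complex_of_real (p_notbox \<rho>I \<rho>F v)"
proof -
  have c: "\<rho>F \<in> carrier_mat d d" "\<rho>I \<in> carrier_mat d d" "proj_perp v \<in> carrier_mat d d"
    using assms hermitian_proj_perp[OF assms(3)] by (auto simp: hermitian_mat_def)
  have "\<rho>F * proj_perp v * \<rho>I * proj_perp v = \<rho>F * (proj_perp v * \<rho>I * proj_perp v)"
    using c by (simp add: assoc_mult_mat[of _ d d _ d _ d])
  then show ?thesis
    using mtrace_hermitian_mult[OF assms(2)
        hermitian_conj[OF hermitian_proj_perp[OF assms(3)] assms(1)]]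
    by (simp add: p_notbox_def)
qed

lemma p_pass_trace:
  assumes "hermitian_mat d \<rho>I" "hermitian_mat d \<rho>F"
  shows "mtrace (\<rho>F * \<rho>I) = complex_of_real (p_pass \<rho>I \<rho>F)"
  using mtrace_hermitian_mult[OF assms(2,1)] by (simp add: p_pass_def)

lemma p_seq_trace:
  assumes "hermitian_mat d \<rho>I" "v \<in> carrier_vec d" "v' \<in> carrier_vec d"
  shows "mtrace (proj v' * proj v * \<rho>I * proj v * proj v') = complex_of_real (p_seq \<rho>I v v')"
proof -
  have c: "\<rho>I \<in> carrier_mat d d" "proj v \<in> carrier_mat d d" "proj v' \<in> carrier_mat d d"
    using assms hermitian_proj by (auto simp: hermitian_mat_def)
  have "proj v' * proj v * \<rho>I * proj v * proj v' = proj v' * (proj v * \<rho>I * proj v) * proj v'"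
    using c by (simp add: assoc_mult_mat[of _ d d _ d _ d])
  moreover have "hermitian_mat d (proj v' * (proj v * \<rho>I * proj v) * proj v')"
    using assms by (intro hermitian_conj hermitian_proj)
  ultimately show ?thesis using mtrace_hermitian by (simp add: p_seq_def)
qed


subsection \<open>A non-real weak value without a paradox\<close>

lemma density_op_proj:
  assumes "v \<in> carrier_vec d" "v \<bullet>c v = 1"
  shows "density_op d (proj v)"
proof -
  have c: "proj v \<in> carrier_mat d d" using assms(1) by (auto simp: proj_def)
  have "0 \<le> (proj v *\<^sub>v w) \<bullet>c w" if w: "w \<in> carrier_vec d" for w
  proof -
    define s where "s = (\<Sum>i<d. v $ i * cnj (w $ i))"
    have "(proj v *\<^sub>v w) $ i = v $ i * cnj s" if "i < d" for i
      using assms(1) w that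
      by (auto simp: proj_def s_def scalar_prod_def cnj_sum sum_distrib_left
          atLeast0LessThan mult_ac intro!: sum.cong)
    then have "(proj v *\<^sub>v w) \<bullet>c w = (\<Sum>i<d. v $ i * cnj s * cnj (w $ i))"
      using w c by (auto simp: scalar_prod_def atLeast0LessThan intro!: sum.cong)
    also have "\<dots> = s * cnj s"
      unfolding s_def sum_distrib_right by (simp add: mult_ac)
    also have "\<dots> = complex_of_real ((cmod s)\<^sup>2)" by (rule complex_norm_square[symmetric])
    also have "0 \<le> \<dots>" by (simp add: less_eq_complex_def)
    finally show ?thesis .
  qed
  moreover have "mtrace (proj v) = 1"
    using assms by (auto simp: mtrace_def proj_def scalar_prod_def atLeast0LessThan)
  ultimately show ?thesis
    using hermitian_proj[OF assms(1)] by (simp add: density_op_def psd_mat_def)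
qed

text \<open>With one box, \<open>|I\<rangle> = (|1\<rangle> + |2\<rangle>)/\<surd>2\<close> and \<open>|F\<rangle> = (|1\<rangle> + \<i>|2\<rangle>)/\<surd>2\<close>, every requirement on the
  scenario holds and the weak value of the excluded projector is \<open>(1 - \<i>)/2\<close>: it is not in
  \<open>[0,1]\<close>, although its real part is, and there is no paradox.\<close>

lemma anomalous_without_paradox:
  "\<exists>\<rho>I \<rho>F e. PPS_scenario 1 \<rho>I \<rho>F e \<and> anomalous \<rho>I \<rho>F (proj (e 2)) \<and> \<not> paradox 1 \<rho>I \<rho>F e"
proof -
  define r where "r = complex_of_real (1 / sqrt 2)"
  have rr: "r * r = 1 / 2" "cnj r = r"
    by (simp_all add: r_def flip: of_real_mult)
  have rr3: "r * (r * x) = x / 2" for x by (simp add: rr(1) flip: mult.assoc)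
  define I where "I = vec 2 (\<lambda>i. r)"
  define F where "F = vec 2 (\<lambda>i. if i = 0 then r else \<i> * r)"
  define e where "e = (\<lambda>b. unit_vec 2 (b - 1) :: complex vec)"
  have two: "{..<2::nat} = {0, 1}" "{0..<2::nat} = {0, 1}" by auto
  have PI: "proj I = mat 2 2 (\<lambda>_. 1 / 2)"
    by (rule eq_matI) (auto simp: proj_def I_def rr)
  have PF: "proj F = mat 2 2 (\<lambda>(i, j). if i = j then 1 / 2 else if i = 0 then - \<i> / 2 else \<i> / 2)"
    by (rule eq_matI) (auto simp: proj_def F_def rr rr3 mult_ac less_2_cases_iff)
  have e: "e (Suc 0) = unit_vec 2 0" "e 2 = unit_vec 2 1" by (simp_all add: e_def)
  have P1: "proj (e (Suc 0)) = mat 2 2 (\<lambda>(i, j). if i = 0 \<and> j = 0 then 1 else 0)"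
    and P2: "proj (e 2) = mat 2 2 (\<lambda>(i, j). if i = 1 \<and> j = 1 then 1 else 0)"
    unfolding e by (rule eq_matI; auto simp: proj_def unit_vec_def)+
  have Q1: "proj_perp (e (Suc 0)) = mat 2 2 (\<lambda>(i, j). if i = 1 \<and> j = 1 then 1 else 0)"
    unfolding proj_perp_def P1 by (rule eq_matI) (auto simp: e)
  note ent = mtrace_def PI PF P1 P2 Q1 scalar_prod_def two
  have box: "p_box (proj I) (proj F) (e (Suc 0)) = 1 / 4"
    by (simp add: p_box_def ent)
  have notbox: "p_notbox (proj I) (proj F) (e (Suc 0)) = 1 / 4"
    by (simp add: p_notbox_def ent)
  have pass: "p_pass (proj I) (proj F) = 1 / 2"
    by (simp add: p_pass_def ent)
  have wv: "weak_value (proj I) (proj F) (proj (e 2)) = (1 - \<i>) / 2"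
    by (simp add: weak_value_def ent complex_eq_iff)
  have "density_op 2 (proj I)" "density_op 2 (proj F)"
    by (intro density_op_proj;
        simp add: I_def F_def scalar_prod_def two rr rr3 mult_ac)+
  moreover have "orthonormal_basis 2 e"
  proof -
    interpret vec_space "TYPE(complex)" 2 .
    have set: "{1..2::nat} = {Suc 0, 2}" by auto
    have "[0..<2] = [0, 1::nat]" by (simp add: upt_rec)
    then have "e ` {1..2} = set (unit_vecs 2)"
      unfolding set by (simp add: e unit_vecs_def)
    then have "basis (e ` {1..2})" using unit_vecs_basis by simp
    moreover have "\<forall>i\<in>{1..2}. \<forall>j\<in>{1..2}. e i \<bullet>c e j = (if i = j then 1 else 0)"
      unfolding set by (auto simp: e scalar_prod_def unit_vec_def two)
    ultimately show ?thesis
      by (auto simp: orthonormal_basis_def e_def)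
  qed
  ultimately have "PPS_scenario 1 (proj I) (proj F) e"
    using box notbox pass by (simp add: PPS_scenario_def flip: numeral_2_eq_2)
  moreover have "anomalous (proj I) (proj F) (proj (e 2))"
    by (auto simp: anomalous_def wv complex_eq_iff)
  moreover have "\<not> paradox 1 (proj I) (proj F) e"
    using box notbox by (simp add: paradox_def abl_def)
  ultimately show ?thesis by blast
qed

end

theory Submission
  imports Defs
begin

text \<open>Expanding \<open>\<Pi>\<^sub>b\<^sup>\<bottom> = 1 - \<Pi>\<^sub>b\<close> turns non-disturbance into \<open>p(b,pass) = Re Tr[\<rho>\<^sub>F \<Pi>\<^sub>b \<rho>\<^sub>I]\<close>, so the ABL
  probability is the real part of the weak value of \<open>\<Pi>\<^sub>b\<close>. The weak values of all \<open>N + 1\<close> projectors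
  add up to 1, which gives the sum formula. Since \<open>Tr[\<rho>\<^sub>F \<rho>\<^sub>I] > 0\<close>, the ABL probabilities are
  nonnegative, so the real part of the excluded weak value never exceeds 1 and can leave \<open>[0,1]\<close> only
  by being negative.\<close>

subsection \<open>The trace of a product of positive semidefinite matrices\<close>

text \<open>Indexing by an arbitrary set instead of \<open>{..<d}\<close> lets an induction delete
  one index without renumbering a submatrix.\<close>

definition psd_form :: "'i set \<Rightarrow> ('i \<Rightarrow> 'i \<Rightarrow> complex) \<Rightarrow> bool" where
  "psd_form S A \<longleftrightarrow> (\<forall>i\<in>S. \<forall>j\<in>S. cnj (A i j) = A j i) \<and>
     (\<forall>v. 0 \<le> Re (\<Sum>i\<in>S. \<Sum>j\<in>S. A i j * (v j * cnj (v i))))"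

lemma psd_formD:
  assumes "psd_form S A"
  shows "0 \<le> Re (\<Sum>i\<in>S. \<Sum>j\<in>S. A i j * (v j * cnj (v i)))"
  using assms by (simp only: psd_form_def)

lemma psd_form_diag:
  assumes "finite S" "psd_form S A" "k \<in> S"
  shows "A k k = complex_of_real (Re (A k k))" "0 \<le> Re (A k k)"
proof -
  have "cnj (A k k) = A k k" using assms by (simp add: psd_form_def)
  then show "A k k = complex_of_real (Re (A k k))" by (simp add: complex_eq_iff)
  define v where "v = (\<lambda>i. if i = k then 1 else 0 :: complex)"
  have "(\<Sum>i\<in>S. \<Sum>j\<in>S. A i j * (v j * cnj (v i))) = (\<Sum>i\<in>S. \<Sum>j\<in>S. if j = k then if i = k then A k k else 0 else 0)"
    by (intro sum.cong refl) (auto simp: v_def)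
  also have "\<dots> = A k k" using assms by simp
  finally show "0 \<le> Re (A k k)" using psd_formD[OF assms(2), of v] by (simp only:)
qed

text \<open>On a vector with entry \<open>t\<close> at \<open>k\<close>, 1 at \<open>j\<close> and 0
  elsewhere, \<open>A k k = 0\<close> removes the quadratic term in \<open>t\<close>. What remains
  is real-affine in \<open>t\<close> and bounded below only if \<open>A k j\<close>
  vanishes.\<close>

lemma psd_form_zero_row:
  assumes S: "finite S" and psd: "psd_form S A" and kj: "k \<in> S" "j \<in> S" and zero: "A k k = 0"
  shows "A k j = 0"
proof (cases "j = k")
  case False
  have h: "cnj (A k j) = A j k" using psd kj by (simp add: psd_form_def)
  have bound: "2 * s * (cmod (A k j))\<^sup>2 \<le> Re (A j j)" for s :: real
  proof -
    \<comment> \<open>Both cross terms become -s times the squared modulus of \<open>A k j\<close>,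
      so the form decreases linearly in \<open>s\<close>.\<close>
    define t where "t = - of_real s * A k j"
    define v where "v = (\<lambda>i. if i = k then t else if i = j then 1 else 0)"
    have "(\<Sum>i\<in>S. \<Sum>l\<in>S. A i l * (v l * cnj (v i))) =
        (\<Sum>i\<in>{k,j}. \<Sum>l\<in>{k,j}. A i l * (v l * cnj (v i)))"
    proof -
      have "(\<Sum>l\<in>S. A i l * (v l * cnj (v i))) = (\<Sum>l\<in>{k,j}. A i l * (v l * cnj (v i)))" for i
        using S kj by (intro sum.mono_neutral_right) (auto simp: v_def)
      moreover have "(\<Sum>i\<in>S. \<Sum>l\<in>{k,j}. A i l * (v l * cnj (v i))) =
          (\<Sum>i\<in>{k,j}. \<Sum>l\<in>{k,j}. A i l * (v l * cnj (v i)))"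
        using S kj by (intro sum.mono_neutral_right) (auto simp: v_def)
      ultimately show ?thesis by simp
    qed
    also have "\<dots> = A j j + A k j * cnj t + A j k * t"
      using False zero by (simp add: v_def)
    also have "\<dots> = A j j - of_real (2 * s * (cmod (A k j))\<^sup>2)"
      unfolding h[symmetric] t_def of_real_mult complex_norm_square by (simp add: algebra_simps)
    finally have "0 \<le> Re (A j j - of_real (2 * s * (cmod (A k j))\<^sup>2))"
      using psd_formD[OF psd, of v] by (simp only:)
    then show ?thesis by simp
  qed
  show ?thesis
  proof (rule ccontr)
    assume "A k j \<noteq> 0"
    \<comment> \<open>This value of \<open>s\<close> makes the left side of \<open>bound\<close>
      exceed the right side by 1.\<close>
    then have "2 * ((Re (A j j) + 1) / (2 * (cmod (A k j))\<^sup>2)) * (cmod (A k j))\<^sup>2 = Re (A j j) + 1"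
      by (simp add: field_simps)
    then show False using bound[of "(Re (A j j) + 1) / (2 * (cmod (A k j))\<^sup>2)"] by simp
  qed
qed (use zero in simp)

text \<open>Induction on the index set: subtracting \<open>a a\<^sup>* / A\<^sub>k\<^sub>k\<close>, where \<open>a\<close> is column \<open>k\<close> of \<open>A\<close>, leaves the
  Schur complement, which is positive semidefinite on the remaining indices. If \<open>A\<^sub>k\<^sub>k = 0\<close>, then
  \<open>a = 0\<close>, and the convention \<open>x / 0 = 0\<close> makes the same formulas work.\<close>

lemma psd_form_trace_nonneg:
  assumes "finite S" "psd_form S A" "psd_form S B"
  shows "0 \<le> Re (\<Sum>i\<in>S. \<Sum>j\<in>S. A i j * B j i)"
  using assms
proof (induction S arbitrary: A rule: finite_induct)
  case (insert k S)
  note A = \<open>psd_form (insert k S) A\<close> and B = \<open>psd_form (insert k S) B\<close>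
  define c where "c = Re (A k k)"
  define A' where "A' = (\<lambda>i j. A i j - A i k * A k j / A k k)"
  have fin: "finite (insert k S)" using insert by simp
  have c: "A k k = of_real c" "0 \<le> c"
    using psd_form_diag[OF fin A, of k] by (auto simp: c_def)
  have herm: "cnj (A i j) = A j i" if "i \<in> insert k S" "j \<in> insert k S" for i j
    using A that unfolding psd_form_def by blast
  have row: "A' k j = 0" if "j \<in> insert k S" for j
    using psd_form_zero_row[OF fin A _ that] by (cases "A k k = 0") (auto simp: A'_def)
  have herm': "cnj (A' i j) = A' j i" if "i \<in> insert k S" "j \<in> insert k S" for i j
    using that by (simp add: A'_def herm)
  have col: "A' i k = 0" if "i \<in> insert k S" for i
    using row[OF that] herm'[of k i] that by simp
  have restrict: "(\<Sum>i\<in>insert k S. \<Sum>j\<in>insert k S. A' i j * X j i) =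
      (\<Sum>i\<in>S. \<Sum>j\<in>S. A' i j * X j i)" for X
    using insert(1,2) row col by simp
  \<comment> \<open>\<open>X\<close> stays general for two uses: a rank-one \<open>X\<close> shows
    that the Schur complement is positive semidefinite, and \<open>X = B\<close> gives the
    trace.\<close>
  have split: "(\<Sum>i\<in>insert k S. \<Sum>j\<in>insert k S. A i j * X j i) =
      (\<Sum>i\<in>S. \<Sum>j\<in>S. A' i j * X j i) +
      (\<Sum>i\<in>insert k S. \<Sum>j\<in>insert k S. A i k * A k j * X j i) / of_real c" for X
  proof -
    have "(\<Sum>i\<in>insert k S. \<Sum>j\<in>insert k S. A i j * X j i) =
        (\<Sum>i\<in>insert k S. \<Sum>j\<in>insert k S. A' i j * X j i + A i k * A k j * X j i / of_real c)"
      by (intro sum.cong refl) (simp add: A'_def c(1) ring_distribs)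
    also have "\<dots> = (\<Sum>i\<in>insert k S. \<Sum>j\<in>insert k S. A' i j * X j i) +
        (\<Sum>i\<in>insert k S. \<Sum>j\<in>insert k S. A i k * A k j * X j i) / of_real c"
      by (simp only: sum.distrib sum_divide_distrib)
    finally show ?thesis by (simp only: restrict)
  qed
  have "psd_form S A'"
    unfolding psd_form_def
  proof (intro conjI ballI allI)
    fix v
    \<comment> \<open>The entry at \<open>k\<close> is chosen so that row \<open>k\<close> of
      \<open>A\<close> annihilates \<open>w\<close>, which removes the rank-one term. For
      \<open>c = 0\<close> that term is 0 because it is divided by 0.\<close>
    define w where "w = (\<lambda>i. if i = k then - (\<Sum>j\<in>S. A k j * v j) / of_real c else v i)"
    have w: "w i = v i" if "i \<in> S" for i using that insert(2) by (auto simp: w_def)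
    have "(\<Sum>i\<in>insert k S. \<Sum>j\<in>insert k S. A i k * A k j * (w j * cnj (w i))) =
        (\<Sum>i\<in>insert k S. A i k * cnj (w i)) * (\<Sum>j\<in>insert k S. A k j * w j)"
      unfolding sum_product by (intro sum.cong refl) (simp only: mult_ac)
    moreover have "(\<Sum>j\<in>insert k S. A k j * w j) = 0" if "c \<noteq> 0"
    proof -
      have "(\<Sum>j\<in>S. A k j * w j) = (\<Sum>j\<in>S. A k j * v j)"
        by (intro sum.cong refl) (simp add: w)
      then show ?thesis using insert(1,2) that by (simp add: c(1) w_def)
    qed
    ultimately have "(\<Sum>i\<in>insert k S. \<Sum>j\<in>insert k S. A i k * A k j * (w j * cnj (w i))) / of_real c = 0"
      by (cases "c = 0") auto
    then have "(\<Sum>i\<in>insert k S. \<Sum>j\<in>insert k S. A i j * (w j * cnj (w i))) =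
        (\<Sum>i\<in>S. \<Sum>j\<in>S. A' i j * (w j * cnj (w i)))"
      using split[of "\<lambda>j i. w j * cnj (w i)"] by simp
    also have "\<dots> = (\<Sum>i\<in>S. \<Sum>j\<in>S. A' i j * (v j * cnj (v i)))"
      by (intro sum.cong refl) (simp add: w)
    finally show "0 \<le> Re (\<Sum>i\<in>S. \<Sum>j\<in>S. A' i j * (v j * cnj (v i)))"
      using psd_formD[OF A, of w] by (simp only:)
  qed (simp add: herm')
  moreover have "psd_form S B"
    unfolding psd_form_def
  proof (intro conjI ballI allI)
    fix v :: "'a \<Rightarrow> complex"
    \<comment> \<open>Extension by zero turns the form of \<open>B\<close> on \<open>S\<close> into
      a value of its form on \<open>insert k S\<close>.\<close>
    define w where "w = (\<lambda>i. if i = k then 0 else v i)"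
    have "w i = v i" if "i \<in> S" for i using that insert(2) by (auto simp: w_def)
    then have "(\<Sum>i\<in>S. \<Sum>j\<in>S. B i j * (w j * cnj (w i))) = (\<Sum>i\<in>S. \<Sum>j\<in>S. B i j * (v j * cnj (v i)))"
      by (intro sum.cong refl) simp
    moreover have "w k = 0" by (simp add: w_def)
    ultimately have "(\<Sum>i\<in>insert k S. \<Sum>j\<in>insert k S. B i j * (w j * cnj (w i))) =
        (\<Sum>i\<in>S. \<Sum>j\<in>S. B i j * (v j * cnj (v i)))"
      using insert(1,2) by simp
    then show "0 \<le> Re (\<Sum>i\<in>S. \<Sum>j\<in>S. B i j * (v j * cnj (v i)))"
      using psd_formD[OF B, of w] by (simp only:)
  qed (use B in \<open>simp add: psd_form_def\<close>)
  ultimately have "0 \<le> Re (\<Sum>i\<in>S. \<Sum>j\<in>S. A' i j * B j i)"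
    by (rule insert.IH)
  \<comment> \<open>The rank-one term is the form of \<open>B\<close> evaluated at column
    \<open>k\<close> of \<open>A\<close>, divided by \<open>c\<close>.\<close>
  moreover have "0 \<le> Re ((\<Sum>i\<in>insert k S. \<Sum>j\<in>insert k S. A i k * A k j * B j i) / of_real c)"
  proof -
    have "(\<Sum>i\<in>insert k S. \<Sum>j\<in>insert k S. A i k * A k j * B j i) =
        (\<Sum>j\<in>insert k S. \<Sum>i\<in>insert k S. A i k * A k j * B j i)"
      by (rule sum.swap)
    also have "\<dots> = (\<Sum>j\<in>insert k S. \<Sum>i\<in>insert k S. B j i * (A i k * cnj (A j k)))"
      by (intro sum.cong refl) (simp add: herm mult_ac)
    finally have "0 \<le> Re (\<Sum>i\<in>insert k S. \<Sum>j\<in>insert k S. A i k * A k j * B j i)"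
      using psd_formD[OF B, of "\<lambda>i. A i k"] by (simp only:)
    then show ?thesis
      unfolding Re_divide_of_real using c(2) by (rule divide_nonneg_nonneg)
  qed
  ultimately show ?case
    unfolding split by simp
qed simp

section \<open>Transfer from index forms to matrices\<close>

lemma mtrace_mult2:
  assumes "A \<in> carrier_mat d d" "B \<in> carrier_mat d d"
  shows "mtrace (A * B) = (\<Sum>i<d. \<Sum>j<d. A $$ (i, j) * B $$ (j, i))"
  using assms mult_index[OF assms] by (simp add: mtrace_def)

lemma mult_mat_vec_inner:
  assumes "A \<in> carrier_mat d d" "v \<in> carrier_vec d"
  shows "(A *\<^sub>v v) \<bullet>c v = (\<Sum>i<d. \<Sum>j<d. A $$ (i, j) * (v $ j * cnj (v $ i)))"
  using assms
  by (auto simp: scalar_prod_def atLeast0LessThan sum_distrib_left sum_distrib_right mult_ac intro!: sum.cong)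

lemma psd_form_psd_mat:
  assumes "psd_mat d A"
  shows "psd_form {..<d} (\<lambda>i j. A $$ (i, j))"
  unfolding psd_form_def
proof (intro conjI ballI allI)
  have h: "hermitian_mat d A" using assms by (simp add: psd_mat_def)
  show "cnj (A $$ (i, j)) = A $$ (j, i)" if "i \<in> {..<d}" "j \<in> {..<d}" for i j
    using hermitian_matD(2)[OF h] that by simp
  fix v :: "nat \<Rightarrow> complex"
  have "0 \<le> (A *\<^sub>v vec d v) \<bullet>c vec d v" using assms by (simp add: psd_mat_def)
  then have "0 \<le> Re ((A *\<^sub>v vec d v) \<bullet>c vec d v)" by (simp add: less_eq_complex_def)
  then show "0 \<le> Re (\<Sum>i<d. \<Sum>j<d. A $$ (i, j) * (v j * cnj (v i)))"
    using hermitian_matD(1)[OF h] by (simp add: mult_mat_vec_inner)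
qed

text \<open>Applied to the two states, this turns a nonzero passing probability into a positive
  one.\<close>

lemma psd_mat_trace_mult_nonneg:
  assumes "psd_mat d A" "psd_mat d B"
  shows "0 \<le> Re (mtrace (A * B))"
proof -
  have "A \<in> carrier_mat d d" "B \<in> carrier_mat d d"
    using assms by (auto simp: psd_mat_def hermitian_mat_def)
  then show ?thesis
    using psd_form_trace_nonneg[OF _ psd_form_psd_mat[OF assms(1)] psd_form_psd_mat[OF assms(2)]]
    by (simp add: mtrace_mult2)
qed


subsection \<open>Traces with rank-one projectors\<close>

lemma proj_carrier: "v \<in> carrier_vec d \<Longrightarrow> proj v \<in> carrier_mat d d"
  by (auto simp: proj_def)

lemma mult_proj_index:
  assumes "A \<in> carrier_mat d d" "v \<in> carrier_vec d" "i < d" "j < d"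
  shows "(A * proj v) $$ (i, j) = (A *\<^sub>v v) $ i * cnj (v $ j)"
  using assms
  by (auto simp: proj_def scalar_prod_def sum_distrib_left sum_distrib_right mult_ac intro!: sum.cong)

lemma proj_mult_vec:
  assumes "v \<in> carrier_vec d" "u \<in> carrier_vec d"
  shows "proj v *\<^sub>v u = (u \<bullet>c v) \<cdot>\<^sub>v v"
  using assms
  by (intro eq_vecI) (auto simp: proj_def scalar_prod_def sum_distrib_left sum_distrib_right mult_ac intro!: sum.cong)

text \<open>Both \<open>A * proj v\<close> and \<open>B * proj v\<close> have rank at most one, so
  the trace factors into two expectation values; for states both are nonnegative.\<close>

lemma mtrace_mult_proj_mult_proj:
  assumes "A \<in> carrier_mat d d" "B \<in> carrier_mat d d" "v \<in> carrier_vec d"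
  shows "mtrace (A * proj v * B * proj v) = ((A *\<^sub>v v) \<bullet>c v) * ((B *\<^sub>v v) \<bullet>c v)"
proof -
  note P = proj_carrier[OF assms(3)]
  have "mtrace (A * proj v * B * proj v) = mtrace ((A * proj v) * (B * proj v))"
    using assms P by (simp add: assoc_mult_mat[of _ d d _ d _ d])
  \<comment> \<open>Exchanging the two conjugated entries of \<open>v\<close> separates the double
    sum.\<close>
  also have "\<dots> = (\<Sum>i<d. \<Sum>j<d. ((A *\<^sub>v v) $ i * cnj (v $ i)) * ((B *\<^sub>v v) $ j * cnj (v $ j)))"
    unfolding mtrace_mult2[OF mult_carrier_mat[OF assms(1) P] mult_carrier_mat[OF assms(2) P]]
    using assms by (intro sum.cong refl) (simp del: index_mult_mat index_mult_mat_vec add: mult_proj_index mult_ac)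
  also have "\<dots> = ((A *\<^sub>v v) \<bullet>c v) * ((B *\<^sub>v v) \<bullet>c v)"
    using assms(3) by (simp add: sum_product scalar_prod_def atLeast0LessThan del: index_mult_mat_vec)
  finally show ?thesis .
qed

lemma p_box_nonneg:
  assumes "psd_mat d \<rho>I" "psd_mat d \<rho>F" "v \<in> carrier_vec d"
  shows "0 \<le> p_box \<rho>I \<rho>F v"
proof -
  have "\<rho>I \<in> carrier_mat d d" "\<rho>F \<in> carrier_mat d d"
    using assms by (auto simp: psd_mat_def hermitian_mat_def)
  moreover have "0 \<le> (\<rho>F *\<^sub>v v) \<bullet>c v" "0 \<le> (\<rho>I *\<^sub>v v) \<bullet>c v"
    using assms by (auto simp: psd_mat_def)
  ultimately show ?thesis
    using assms(3) by (simp add: p_box_def mtrace_mult_proj_mult_proj less_eq_complex_def)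
qed

section \<open>Expansion of the complementary outcome\<close>

lemma mtrace_mult_comm:
  assumes "A \<in> carrier_mat d d" "B \<in> carrier_mat d d"
  shows "mtrace (A * B) = mtrace (B * A)"
  unfolding mtrace_mult2[OF assms] mtrace_mult2[OF assms(2,1)]
  by (subst sum.swap) (simp add: mult_ac)

text \<open>Taking adjoints reverses the product and conjugates the trace; cyclicity then brings
  \<open>A\<close> back to the front. This pairs the cross terms of \<open>p_notbox\<close>.\<close>

lemma mtrace_hermitian_mult3:
  assumes "hermitian_mat d A" "hermitian_mat d B" "hermitian_mat d C"
  shows "mtrace (A * B * C) = cnj (mtrace (A * C * B))"
proof -
  have c: "A \<in> carrier_mat d d" "B \<in> carrier_mat d d" "C \<in> carrier_mat d d"
    using assms by (auto simp: hermitian_mat_def)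
  have h: "cnj ((X * Y) $$ (i, j)) = (Y * X) $$ (j, i)"
    if X: "hermitian_mat d X" and Y: "hermitian_mat d Y" and "i < d" "j < d" for X Y i j
  proof -
    note cX = hermitian_matD(1)[OF X] and cY = hermitian_matD(1)[OF Y]
    show ?thesis
      unfolding mult_index[OF cX cY that(3,4)] mult_index[OF cY cX that(4,3)] cnj_sum
      using that by (intro sum.cong refl) (simp add: hermitian_matD(2)[OF X] hermitian_matD(2)[OF Y] mult_ac)
  qed
  have "mtrace (A * B * C) = mtrace (A * (B * C))" using c by (simp add: assoc_mult_mat[of _ d d _ d _ d])
  also have "\<dots> = (\<Sum>i<d. \<Sum>j<d. A $$ (i, j) * (B * C) $$ (j, i))"
    using c by (intro mtrace_mult2) auto
  also have "\<dots> = cnj (\<Sum>i<d. \<Sum>j<d. A $$ (j, i) * (C * B) $$ (i, j))"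
    unfolding cnj_sum
    by (intro sum.cong refl) (simp add: h assms hermitian_matD(2)[OF assms(1)] del: index_mult_mat)
  also have "\<dots> = cnj (\<Sum>j<d. \<Sum>i<d. A $$ (j, i) * (C * B) $$ (i, j))"
    by (subst sum.swap) simp
  also have "\<dots> = cnj (mtrace (A * (C * B)))"
    using c by (subst mtrace_mult2[of A d "C * B"]) auto
  also have "\<dots> = cnj (mtrace (A * C * B))" using c by (simp add: assoc_mult_mat[of _ d d _ d _ d])
  finally show ?thesis .
qed

lemma mtrace_minus:
  assumes "A \<in> carrier_mat d d" "B \<in> carrier_mat d d"
  shows "mtrace (A - B) = mtrace A - mtrace B"
  using assms by (simp add: mtrace_def sum_subtractf)

text \<open>Expanding both complements gives four traces. The two cross terms are complex
  conjugates, hence twice a real part.\<close>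

lemma p_notbox_expand:
  assumes "hermitian_mat d \<rho>I" "hermitian_mat d \<rho>F" "v \<in> carrier_vec d"
  shows "p_notbox \<rho>I \<rho>F v =
    p_pass \<rho>I \<rho>F - 2 * Re (mtrace (\<rho>F * proj v * \<rho>I)) + p_box \<rho>I \<rho>F v"
proof -
  let ?P = "proj v"
  have c: "\<rho>I \<in> carrier_mat d d" "\<rho>F \<in> carrier_mat d d" "?P \<in> carrier_mat d d"
    using assms by (auto simp: hermitian_mat_def proj_carrier)
  have Q: "proj_perp v = 1\<^sub>m d - ?P" using assms(3) by (simp add: proj_perp_def)
  have 1: "\<rho>F * (1\<^sub>m d - ?P) * \<rho>I = \<rho>F * \<rho>I - \<rho>F * ?P * \<rho>I"
    using c by (simp add: mult_minus_distrib_mat[of _ d d _ d] minus_mult_distrib_mat[of _ d d])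
  have 2: "(\<rho>F * \<rho>I - \<rho>F * ?P * \<rho>I) * (1\<^sub>m d - ?P) =
      (\<rho>F * \<rho>I - \<rho>F * ?P * \<rho>I) - (\<rho>F * \<rho>I * ?P - \<rho>F * ?P * \<rho>I * ?P)"
  proof -
    let ?X = "\<rho>F * \<rho>I - \<rho>F * ?P * \<rho>I"
    have X: "?X \<in> carrier_mat d d" using c by auto
    have "?X * (1\<^sub>m d - ?P) = ?X - ?X * ?P"
      using mult_minus_distrib_mat[OF X one_carrier_mat c(3)] right_mult_one_mat[OF X] by simp
    also have "?X * ?P = \<rho>F * \<rho>I * ?P - \<rho>F * ?P * \<rho>I * ?P"
      using c by (intro minus_mult_distrib_mat) auto
    finally show ?thesis .
  qed
  have "mtrace (\<rho>F * proj_perp v * \<rho>I * proj_perp v) =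
      mtrace (\<rho>F * \<rho>I) - mtrace (\<rho>F * ?P * \<rho>I)
      - (mtrace (\<rho>F * \<rho>I * ?P) - mtrace (\<rho>F * ?P * \<rho>I * ?P))"
  proof -
    have C: "\<rho>F * \<rho>I \<in> carrier_mat d d" "\<rho>F * ?P * \<rho>I \<in> carrier_mat d d"
      "\<rho>F * \<rho>I * ?P \<in> carrier_mat d d" "\<rho>F * ?P * \<rho>I * ?P \<in> carrier_mat d d"
      using c by auto
    show ?thesis
      unfolding Q 1 2 mtrace_minus[OF C(1,2)] mtrace_minus[OF C(3,4)]
        mtrace_minus[OF minus_carrier_mat[OF C(2)] minus_carrier_mat[OF C(4)]] ..
  qed
  moreover have "mtrace (\<rho>F * \<rho>I * ?P) = cnj (mtrace (\<rho>F * ?P * \<rho>I))"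
    using assms by (intro mtrace_hermitian_mult3 hermitian_proj)
  ultimately show ?thesis by (simp add: p_notbox_def p_pass_def p_box_def)
qed


subsection \<open>Orthonormal bases\<close>

text \<open>Orthonormality says that the adjoint of the matrix of basis vectors is a left inverse.
  The matrix is square, so it is also a right inverse, and this is the completeness
  relation.\<close>

lemma orthonormal_resolution:
  assumes "orthonormal_basis d e" "i < d" "j < d"
  shows "(\<Sum>b = 1..d. proj (e b) $$ (i, j)) = (if i = j then 1 else 0)"
proof -
  have e: "e (Suc b) \<in> carrier_vec d" if "b < d" for b
    using assms(1) that by (simp add: orthonormal_basis_def)
  have ip: "e (Suc a) \<bullet>c e (Suc b) = (if a = b then 1 else 0)" if "a < d" "b < d" for a b
    using assms(1) that by (simp add: orthonormal_basis_def)
  \<comment> \<open>\<open>Suc b\<close> appears because matrix columns are numbered from 0 and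
    basis vectors from 1.\<close>
  define U where "U = mat d d (\<lambda>(i, b). e (Suc b) $ i)"
  define V where "V = mat d d (\<lambda>(b, i). cnj (e (Suc b) $ i))"
  have UV: "U \<in> carrier_mat d d" "V \<in> carrier_mat d d" by (auto simp: U_def V_def)
  have "V * U = 1\<^sub>m d"
  proof (rule eq_matI)
    fix a b assume ab: "a < dim_row (1\<^sub>m d :: complex mat)" "b < dim_col (1\<^sub>m d :: complex mat)"
    then have "(V * U) $$ (a, b) = e (Suc b) \<bullet>c e (Suc a)"
      using e[of a] e[of b] by (auto simp: U_def V_def scalar_prod_def mult_ac intro!: sum.cong)
    then show "(V * U) $$ (a, b) = 1\<^sub>m d $$ (a, b)" using ab by (simp add: ip)
  qed (auto simp: U_def V_def)
  then have "U * V = 1\<^sub>m d" by (rule mat_mult_left_right_inverse[OF UV(2,1)])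
  then have "(\<Sum>b<d. U $$ (i, b) * V $$ (b, j)) = (if i = j then 1 else 0)"
    using mult_index[OF UV assms(2,3)] assms(2,3) by simp
  also have "(\<Sum>b<d. U $$ (i, b) * V $$ (b, j)) = (\<Sum>b<d. proj (e (Suc b)) $$ (i, j))"
    using assms(2,3) e by (intro sum.cong refl) (simp add: U_def V_def proj_def carrier_vecD[OF e])
  also have "\<dots> = (\<Sum>b = 1..d. proj (e b) $$ (i, j))"
    by (simp add: sum.atLeast1_atMost_eq)
  finally show ?thesis by simp
qed

text \<open>This inserts the completeness relation between \<open>A\<close> and \<open>B\<close>;
  dividing by the trace gives the sum rule for weak values.\<close>

lemma sum_mtrace_mult_proj_mult:
  assumes "orthonormal_basis d e" "A \<in> carrier_mat d d" "B \<in> carrier_mat d d"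
  shows "(\<Sum>b = 1..d. mtrace (A * proj (e b) * B)) = mtrace (A * B)"
proof -
  have BA: "B * A \<in> carrier_mat d d" using assms by auto
  \<comment> \<open>Cyclicity isolates the projector, so only its entries depend on
    \<open>b\<close>.\<close>
  have "mtrace (A * proj (e b) * B) = (\<Sum>i<d. \<Sum>j<d. (B * A) $$ (i, j) * proj (e b) $$ (j, i))"
    if "b \<in> {1..d}" for b
  proof -
    have P: "proj (e b) \<in> carrier_mat d d"
      using assms(1) that by (auto simp: orthonormal_basis_def proj_carrier)
    have "mtrace (A * proj (e b) * B) = mtrace (B * (A * proj (e b)))"
      using assms P by (intro mtrace_mult_comm) auto
    also have "\<dots> = mtrace (B * A * proj (e b))"
      using assms P by (simp add: assoc_mult_mat[of _ d d _ d _ d])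
    finally show ?thesis using mtrace_mult2[OF BA P] by simp
  qed
  then have "(\<Sum>b = 1..d. mtrace (A * proj (e b) * B)) =
      (\<Sum>b = 1..d. \<Sum>i<d. \<Sum>j<d. (B * A) $$ (i, j) * proj (e b) $$ (j, i))"
    by (rule sum.cong[OF refl])
  also have "\<dots> = (\<Sum>i<d. \<Sum>b = 1..d. \<Sum>j<d. (B * A) $$ (i, j) * proj (e b) $$ (j, i))"
    by (rule sum.swap)
  also have "\<dots> = (\<Sum>i<d. \<Sum>j<d. \<Sum>b = 1..d. (B * A) $$ (i, j) * proj (e b) $$ (j, i))"
    by (rule sum.cong[OF refl], rule sum.swap)
  also have "\<dots> = (\<Sum>i<d. \<Sum>j<d. (B * A) $$ (i, j) * (\<Sum>b = 1..d. proj (e b) $$ (j, i)))"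
    by (simp only: sum_distrib_left)
  also have "\<dots> = (\<Sum>i<d. \<Sum>j<d. (B * A) $$ (i, j) * (if j = i then 1 else 0))"
    by (intro sum.cong refl) (simp only: orthonormal_resolution[OF assms(1)] lessThan_iff)
  also have "\<dots> = mtrace (B * A)" using BA assms(3)
    by (simp add: mtrace_def if_distrib[of "(*) _"] cong: if_cong del: index_mult_mat(1))
  also have "\<dots> = mtrace (A * B)" using assms by (intro mtrace_mult_comm)
  finally show ?thesis .
qed

section \<open>Spectrum of a rank-one projector\<close>

text \<open>The orthogonal vector \<open>u\<close> supplies the eigenvalue 0; in dimension one the
  interval would be the single point 1.\<close>

lemma spectral_interval_proj:
  assumes v: "v \<in> carrier_vec d" "v \<bullet>c v = 1"
    and u: "u \<in> carrier_vec d" "u \<noteq> 0\<^sub>v d" "u \<bullet>c v = 0"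
  shows "spectral_interval (proj v) = {0..1}"
proof -
  have v0: "v \<noteq> 0\<^sub>v d" using v by auto
  have dim: "dim_row (proj v) = d" using v(1) by (simp add: proj_def)
  have "proj v *\<^sub>v v = 1 \<cdot>\<^sub>v v" using v by (simp add: proj_mult_vec)
  then have e1: "eigenvalue (proj v) 1"
    using v(1) v0 dim by (auto simp: eigenvalue_def eigenvector_def)
  have "proj v *\<^sub>v u = 0 \<cdot>\<^sub>v u" using u v(1) by (auto simp: proj_mult_vec)
  then have e0: "eigenvalue (proj v) 0"
    using u dim by (auto simp: eigenvalue_def eigenvector_def)
  have "r = 0 \<or> r = 1" if r: "eigenvalue (proj v) (complex_of_real r)" for r
  proof -
    obtain w where w: "w \<in> carrier_vec d" "w \<noteq> 0\<^sub>v d" "proj v *\<^sub>v w = of_real r \<cdot>\<^sub>v w"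
      using r unfolding eigenvalue_def eigenvector_def dim by auto
    then have eq: "(w \<bullet>c v) \<cdot>\<^sub>v v = of_real r \<cdot>\<^sub>v w" using v(1) by (simp add: proj_mult_vec)
    \<comment> \<open>Pairing the eigenvector equation with \<open>v\<close> leaves
      \<open>r = 1\<close> or \<open>w\<close> orthogonal to \<open>v\<close>; in the latter case
      \<open>r\<close> times \<open>w\<close> is zero.\<close>
    then have "((w \<bullet>c v) \<cdot>\<^sub>v v) \<bullet>c v = (of_real r \<cdot>\<^sub>v w) \<bullet>c v" by simp
    then have "w \<bullet>c v = of_real r * (w \<bullet>c v)" using v w(1) by simp
    then consider "r = 1" | "w \<bullet>c v = 0" by fastforce
    then show ?thesis
    proof cases
      case 2
      have "0 \<cdot>\<^sub>v v = 0\<^sub>v d" using v(1) by auto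
      then have "of_real r \<cdot>\<^sub>v w = 0\<^sub>v d" using eq 2 by simp
      moreover obtain i where "i < d" "w $ i \<noteq> 0" using w(1,2) by (metis eq_vecI carrier_vecD index_zero_vec)
      ultimately have "complex_of_real r * w $ i = 0" using w(1) by (metis carrier_vecD index_smult_vec(1) index_zero_vec(1))
      then show ?thesis using \<open>w $ i \<noteq> 0\<close> by simp
    qed simp
  qed
  then have "{r. eigenvalue (proj v) (complex_of_real r)} = {0, 1}"
    using e0 e1 by auto
  then show ?thesis by (simp add: spectral_interval_def)
qed

section \<open>ABL probabilities as weak values\<close>

text \<open>In the expansion of \<open>p_notbox\<close>, non-disturbance cancels
  \<open>p_pass\<close> and leaves \<open>p_box\<close> equal to the real part of the weak-value
  numerator. The denominators agree because that trace is real.\<close>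

lemma abl_eq_Re_weak_value:
  assumes "hermitian_mat d \<rho>I" "hermitian_mat d \<rho>F" "v \<in> carrier_vec d"
    and "p_box \<rho>I \<rho>F v + p_notbox \<rho>I \<rho>F v = p_pass \<rho>I \<rho>F"
  shows "abl \<rho>I \<rho>F v = Re (weak_value \<rho>I \<rho>F (proj v))"
  using assms(4) p_notbox_expand[OF assms(1-3)]
  by (simp add: abl_def weak_value_def p_pass_trace[OF assms(1,2)])

text \<open>The equivalence with anomaly is stated for the real-part reading. Under the complex
  reading a non-real weak value is always anomalous, so the converse is restricted to real weak
  values; \<open>anomalous_without_paradox\<close> shows that it fails in general.\<close>

theorem mainTheorem2:
  fixes N :: nat and \<rho>I \<rho>F :: "complex mat" and e :: "nat \<Rightarrow> complex vec"
  assumes "N \<ge> 1"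
    and "PPS_scenario N \<rho>I \<rho>F e"
  shows "(\<Sum>b = 1..N. abl \<rho>I \<rho>F (e b)) = 1 - Re (weak_value \<rho>I \<rho>F (proj (e (N + 1))))
    \<and> (paradox N \<rho>I \<rho>F e \<longleftrightarrow> Re (weak_value \<rho>I \<rho>F (proj (e (N + 1)))) < 0)
    \<and> (paradox N \<rho>I \<rho>F e \<longleftrightarrow> anomalous_Re \<rho>I \<rho>F (proj (e (N + 1))))
    \<and> (paradox N \<rho>I \<rho>F e \<longrightarrow> anomalous \<rho>I \<rho>F (proj (e (N + 1))))
    \<and> (weak_value \<rho>I \<rho>F (proj (e (N + 1))) \<in> \<real>
         \<longrightarrow> (paradox N \<rho>I \<rho>F e \<longleftrightarrow> anomalous \<rho>I \<rho>F (proj (e (N + 1)))))"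
proof -
  let ?w = "\<lambda>b. weak_value \<rho>I \<rho>F (proj (e b))"
  have psd: "psd_mat (N + 1) \<rho>I" "psd_mat (N + 1) \<rho>F"
    and basis: "orthonormal_basis (N + 1) e"
    and pass: "p_pass \<rho>I \<rho>F \<noteq> 0"
    using assms(2) by (auto simp: PPS_scenario_def density_op_def)
  have nondist: "p_box \<rho>I \<rho>F (e b) + p_notbox \<rho>I \<rho>F (e b) = p_pass \<rho>I \<rho>F" if "b \<in> {1..N}" for b
    using assms(2) that by (simp add: PPS_scenario_def)
  have e: "e b \<in> carrier_vec (N + 1)" if "b \<in> {1..N + 1}" for b
    using basis that by (simp add: orthonormal_basis_def)
  have herm: "hermitian_mat (N + 1) \<rho>I" "hermitian_mat (N + 1) \<rho>F"
    using psd by (auto simp: psd_mat_def)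
  have "0 \<le> p_pass \<rho>I \<rho>F"
    unfolding p_pass_def by (rule psd_mat_trace_mult_nonneg[OF psd(2,1)])
  with pass have pass_pos: "0 < p_pass \<rho>I \<rho>F" by simp
  have "(\<Sum>b = 1..N + 1. ?w b) = 1"
    using sum_mtrace_mult_proj_mult[OF basis hermitian_matD(1)[OF herm(2)] hermitian_matD(1)[OF herm(1)]]
      pass p_pass_trace[OF herm]
    by (simp add: weak_value_def flip: sum_divide_distrib)
  then have "(\<Sum>b = 1..N. Re (?w b)) + Re (?w (N + 1)) = 1"
    by (simp add: complex_eq_iff)
  moreover have "(\<Sum>b = 1..N. abl \<rho>I \<rho>F (e b)) = (\<Sum>b = 1..N. Re (?w b))"
    using e nondist by (intro sum.cong refl abl_eq_Re_weak_value[OF herm]) auto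
  ultimately have sum: "(\<Sum>b = 1..N. abl \<rho>I \<rho>F (e b)) = 1 - Re (?w (N + 1))" by simp
  have "0 \<le> abl \<rho>I \<rho>F (e b)" if "b \<in> {1..N}" for b
    using p_box_nonneg[OF psd e] nondist[OF that] pass_pos that by (simp add: abl_def)
  then have "0 \<le> (\<Sum>b = 1..N. abl \<rho>I \<rho>F (e b))" by (rule sum_nonneg)
  then have le1: "Re (?w (N + 1)) \<le> 1" using sum by simp
  have paradox: "paradox N \<rho>I \<rho>F e \<longleftrightarrow> Re (?w (N + 1)) < 0"
    using sum by (auto simp: paradox_def)
  have ip: "e i \<bullet>c e j = (if i = j then 1 else 0)" if "i \<in> {1..N + 1}" "j \<in> {1..N + 1}" for i j
    using basis that by (simp add: orthonormal_basis_def)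
  \<comment> \<open>\<open>N \<ge> 1\<close> makes \<open>e 1\<close> distinct from the excluded
    vector, so it can serve as the orthogonal vector.\<close>
  have "e 1 \<noteq> 0\<^sub>v (N + 1)" using ip[of 1 1] by auto
  then have interval: "spectral_interval (proj (e (N + 1))) = {0..1}"
    using assms(1) e[of "N + 1"] e[of 1] ip[of "N + 1" "N + 1"] ip[of 1 "N + 1"]
    by (intro spectral_interval_proj[where u = "e 1" and d = "N + 1"]) auto
  have anom_Re: "anomalous_Re \<rho>I \<rho>F (proj (e (N + 1))) \<longleftrightarrow> Re (?w (N + 1)) < 0"
    unfolding anomalous_Re_def interval using le1 by auto
  have anom: "anomalous \<rho>I \<rho>F (proj (e (N + 1)))" if "Re (?w (N + 1)) < 0"
    unfolding anomalous_def interval using that by auto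
  \<comment> \<open>A real weak value outside the interval must lie below 0, since
    \<open>le1\<close> excludes values above 1.\<close>
  moreover have "Re (?w (N + 1)) < 0"
    if "?w (N + 1) \<in> \<real>" "anomalous \<rho>I \<rho>F (proj (e (N + 1)))"
    using that le1 unfolding anomalous_def interval by (fastforce elim!: Reals_cases)
  ultimately show ?thesis using sum paradox anom_Re by blast
qed

end
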